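(* Suppose the following holds. (i) There exist $\overline a,\underline a\in\mathbb{R}_{>0}$ such that $\overline\alpha(s)\le\overline a s$ and $\underline\alpha(s)\ge\underline a s$ for all $s\ge0$. (ii) $c_{\mathrm{stop}}(x,\theta,\gamma,i)\le|\theta|\,\sigma(x)$ for all $x\in\mathbb{R}^{n_x}$, $\theta\in\Theta$, $\gamma\in(0,1]$, $i\in\mathbb{Z}_{\ge0}$. Let $\gamma_\star\in(1-\underline a/\overline a,1]$ and $a:=\underline a-\overline a+\gamma_\star\overline a$. Then for any $\overline\theta\in(0,a)$, any $\theta\in\Theta$ with $|\theta|\le\overline\theta$, any integer $i\ge2$, any $\gamma\in[\gamma_\star,1]$ and any $x\in\mathcal{X}$, any solution $\widehat\phi_{\gamma,i,\theta}$ initialized at $x$ of the constrained inclusion $x(k+1)\in f(x(k),\widehat H_{\gamma,i}(x(k)))$, $x(k)\in\mathcal{X}$, satisfies $$\sigma(\widehat\phi_{\gamma,i,\theta}(k;x))\le\frac{\overline a}{\underline a}\lambda^k\sigma(x)\qquad\text{for any }k\in\operatorname{dom}\widehat\phi_{\gamma,i,\theta},$$ with $\lambda:=1-\frac{1}{\gamma_\star}(a-\overline\theta)\overline a^{-1}\in(0,1)$.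
   Context: Let $n_x,n_u\in\mathbb{Z}_{>0}$, $f:\mathbb{R}^{n_x}\times\mathbb{R}^{n_u}\to\mathbb{R}^{n_x}$, $\mathcal{U}:\mathbb{R}^{n_x}\rightrightarrows\mathbb{R}^{n_u}$ a set-valued map (admissible inputs), $\mathcal{W}:=\{(x,u):u\in\mathcal{U}(x)\}$, $\ell:\mathbb{R}^{n_x}\times\mathbb{R}^{n_u}\to\mathbb{R}_{\ge 0}$ a stage cost. For $x\in\mathbb{R}^{n_x}$ and a sequence $\mathbf{u}=(u_0,u_1,\dots)$, $\phi(k;x,\mathbf{u}|_k)$ is the state at time $k$ of $x(k+1)=f(x(k),u_k)$, $x(0)=x$; $\mathbf{u}$ is admissible from $x$ if $u_k\in\mathcal{U}(\phi(k;x,\mathbf{u}|_k))$ for all $k\in\mathbb{Z}_{\ge0}$. For $\gamma\in(0,1]$, $V_{\gamma,\star}(x):=\inf_{\mathbf{u}}\sum_{k=0}^\infty\gamma^k\ell(\phi(k;x,\mathbf{u}|_k),u_k)$ over admissible $\mathbf{u}$. Given $V_{\gamma,0}:\mathbb{R}^{n_x}\to\mathbb{R}_{\ge0}$, value iteration defines for $i\in\mathbb{Z}_{>0}$, $V_{\gamma,i}(x):=\inf_{u\in\mathcal{U}(x)}(\ell(x,u)+\gamma V_{\gamma,i-1}(f(x,u)))$. $\sigma:\mathbb{R}^{n_x}\to\mathbb{R}_{\ge0}$ is a given continuous, surjective function. Class $\mathcal{K}_\infty$: continuous, strictly increasing, unbounded functions $\mathbb{R}_{\ge0}\to\mathbb{R}_{\ge0}$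 vanishing at $0$. Standing assumptions. (1) $f$ is continuous; each $\mathcal{U}(x)$ is non-empty and closed; $\ell$ is lower semicontinuous and there is $\alpha_\ell\in\mathcal{K}_\infty$ with $\ell(x,u)\ge\alpha_\ell(|u|)$ for all $(x,u)$; $V_{\gamma,0}$ is lower semicontinuous. (2) There exists $\underline\alpha\in\mathcal{K}_\infty$ with $\ell(x,u)\ge\underline\alpha(\sigma(x))$ for all $(x,u)\in\mathcal{W}$. (3) There exists $\overline\alpha\in\mathcal{K}_\infty$ with $V_{\gamma,i}(x)\le\overline\alpha(\sigma(x))$ and $V_{\gamma,\star}(x)\le\overline\alpha(\sigma(x))$ for all $i\in\mathbb{Z}_{\ge0}$, $\gamma\in(0,1]$, $x\in\mathbb{R}^{n_x}$. The stopping criterion function is $c_{\mathrm{stop}}:\mathbb{R}^{n_x}\times\Theta\times(0,1]\times\mathbb{Z}_{\ge0}\to\mathbb{R}_{\ge0}$, with $\Theta\subset\mathbb{R}^{n_\theta}$, and $\mathcal{X}\subset\mathbb{R}^{n_x}$ is a given set. For $\theta\in\Theta$, $\gamma$ and $i\in\mathbb{Z}_{>0}$ (dependence on $\theta$ suppressed), $$\widehat H_{\gamma,i}(x):=\{u\in\mathcal{U}(x):\ell(x,u)+\gamma V_{\gamma,i-1}(f(x,u))\le V_{\gamma,i-1}(x)+c_{\mathrm{stop}}(x,\theta,\gamma,i)\},$$ which may be empty. A solution $\widehat\phi_{\gamma,i,\theta}(\cdot;x)$ initialized at $x\in\mathcal{X}$ of $x(k+1)\in f(x(k),\widehat H_{\gamma,i}(x(k)))$,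 $x(k)\in\mathcal{X}$, is a sequence defined on a domain of the form $\{0,\dots,K\}$ or $\mathbb{Z}_{\ge0}$, with value $x$ at $0$, all values in $\mathcal{X}$, and whose value at $k+1$ belongs to $\{f(z,u):u\in\widehat H_{\gamma,i}(z)\}$, $z$ being its value at $k$, whenever $k+1$ is in the domain. *)

theory Defs
  imports "HOL-Analysis.Analysis"
begin

(* Class K-infinity comparison functions. Only the values on {0..} matter; nonnegativity there
   follows from strict monotonicity and \<alpha> 0 = 0. *)
definition class_K_inf :: "(real \<Rightarrow> real) \<Rightarrow> bool" where
  "class_K_inf \<alpha> \<longleftrightarrow>
     continuous_on {0..} \<alpha> \<and> strict_mono_on {0..} \<alpha> \<and> \<alpha> 0 = 0 \<and> \<not> bdd_above (\<alpha> ` {0..})"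

definition lower_semicontinuous :: "('a::topological_space \<Rightarrow> real) \<Rightarrow> bool" where
  "lower_semicontinuous g \<longleftrightarrow> (\<forall>x c. c < g x \<longrightarrow> (\<forall>\<^sub>F y in nhds x. c < g y))"

primrec trajectory ::
  "('x \<times> 'u \<Rightarrow> 'x) \<Rightarrow> 'x \<Rightarrow> (nat \<Rightarrow> 'u) \<Rightarrow> nat \<Rightarrow> 'x" where
  "trajectory f x us 0 = x"
| "trajectory f x us (Suc k) = f (trajectory f x us k, us k)"

definition admissible ::
  "('x \<times> 'u \<Rightarrow> 'x) \<Rightarrow> ('x \<Rightarrow> 'u set) \<Rightarrow> 'x \<Rightarrow> (nat \<Rightarrow> 'u) \<Rightarrow> bool" where
  "admissible f U x us \<longleftrightarrow> (\<forall>k. us k \<in> U (trajectory f x us k))"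

(* The infinite-horizon cost may diverge, so it is valued in ennreal; every summand is
   nonnegative for a stage cost l \<ge> 0, so no value is truncated by the embedding. *)
definition V_star ::
  "('x \<times> 'u \<Rightarrow> 'x) \<Rightarrow> ('x \<Rightarrow> 'u set) \<Rightarrow> ('x \<times> 'u \<Rightarrow> real) \<Rightarrow> real \<Rightarrow> 'x \<Rightarrow> ennreal" where
  "V_star f U l \<gamma> x =
     (INF us \<in> {us. admissible f U x us}.
        (\<Sum>k. ennreal (\<gamma> ^ k * l (trajectory f x us k, us k))))"

(* A real infimum suffices: U x is assumed nonempty and the iterates are bounded below by 0. *)
primrec V_iter ::
  "('x \<times> 'u \<Rightarrow> 'x) \<Rightarrow> ('x \<Rightarrow> 'u set) \<Rightarrow> ('x \<times> 'u \<Rightarrow> real) \<Rightarrow> (real \<Rightarrow> 'x \<Rightarrow> real) \<Rightarrow>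
   real \<Rightarrow> nat \<Rightarrow> 'x \<Rightarrow> real" where
  "V_iter f U l V0 \<gamma> 0 = V0 \<gamma>"
| "V_iter f U l V0 \<gamma> (Suc i) =
     (\<lambda>x. INF u \<in> U x. l (x, u) + \<gamma> * V_iter f U l V0 \<gamma> i (f (x, u)))"

(* Only meaningful for i \<ge> 1. *)
definition H_hat ::
  "('x \<times> 'u \<Rightarrow> 'x) \<Rightarrow> ('x \<Rightarrow> 'u set) \<Rightarrow> ('x \<times> 'u \<Rightarrow> real) \<Rightarrow> (real \<Rightarrow> 'x \<Rightarrow> real) \<Rightarrow>
   ('x \<Rightarrow> 'p \<Rightarrow> real \<Rightarrow> nat \<Rightarrow> real) \<Rightarrow> 'p \<Rightarrow> real \<Rightarrow> nat \<Rightarrow> 'x \<Rightarrow> 'u set" where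
  "H_hat f U l V0 c_stop \<theta> \<gamma> i x =
     {u \<in> U x. l (x, u) + \<gamma> * V_iter f U l V0 \<gamma> (i - 1) (f (x, u))
                \<le> V_iter f U l V0 \<gamma> (i - 1) x + c_stop x \<theta> \<gamma> i}"

(* phi, restricted to the time domain D, solves the inclusion x(k+1) \<in> F (x(k)), x(k) \<in> X, with
   initial value x; the values of phi outside D are irrelevant. *)
definition is_solution ::
  "('x \<Rightarrow> 'x set) \<Rightarrow> 'x set \<Rightarrow> 'x \<Rightarrow> nat set \<Rightarrow> (nat \<Rightarrow> 'x) \<Rightarrow> bool" where
  "is_solution F X x D phi \<longleftrightarrow>
     (D = UNIV \<or> (\<exists>K. D = {0..K})) \<and>
     phi 0 = x \<and>
     (\<forall>k\<in>D. phi k \<in> X) \<and>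
     (\<forall>k. Suc k \<in> D \<longrightarrow> phi (Suc k) \<in> F (phi k))"

end

theory Submission
  imports Defs
begin

text \<open>
  The iterate \<open>V\<close> = \<open>V_iter f U l V0 \<gamma> (i - 1)\<close>, which defines the inputs in
  \<open>H_hat f U l V0 c_stop \<theta> \<gamma> i\<close>, is a Lyapunov function for the closed loop. It is squeezed
  between two multiples of \<open>\<sigma>\<close>: \<open>a_lo * \<sigma> \<le> V \<le> a_up * \<sigma>\<close>. The upper bound is the
  assumed one. The lower bound holds because \<open>i - 1 \<ge> 1\<close>, so that \<open>V\<close> is an infimum of terms which
  each contain a stage cost (\<open>V_iter_Suc_lower_bound\<close>). Along an input of \<open>H_hat\<close>,
  \<open>\<gamma> * V (f (z, u)) \<le> V z + c_stop z \<theta> \<gamma> i - l (z, u) \<le> V z - (a_lo - \<theta>_bar) * \<sigma> z\<close>,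
  and bounding \<open>\<sigma> z\<close> from below by \<open>V z / a_up\<close> makes \<open>V\<close> contract at each step by the factor
  \<open>(1 - (a_lo - \<theta>_bar) / a_up) / \<gamma>_star\<close>, which is \<open>lam\<close> written differently
  (\<open>contraction_of_decrease\<close>, \<open>contraction_rate_eq\<close>). Iterating
  (\<open>is_solution_geometric_decay\<close>) and returning from \<open>V\<close> to \<open>\<sigma>\<close> costs the factor \<open>a_up / a_lo\<close>.

  That \<open>\<gamma>_star\<close> is positive rests on \<open>a_lo \<le> a_up\<close>, which the squeeze yields at a point where
  \<open>\<sigma> = 1\<close>; such a point exists since \<open>\<sigma>\<close> is surjective.
\<close>

lemma V_iter_nonneg:
  assumes "\<And>x u. 0 \<le> l (x, u)" "\<And>x. U x \<noteq> {}" "\<And>x. 0 \<le> V0 \<gamma> x" "0 \<le> \<gamma>"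
  shows "0 \<le> V_iter f U l V0 \<gamma> j x"
proof (induction j arbitrary: x)
  case 0
  then show ?case using assms by simp
next
  case (Suc j)
  show ?case
    unfolding V_iter.simps
    by (rule cINF_greatest) (use assms Suc in auto)
qed

lemma V_iter_Suc_lower_bound:
  assumes "\<And>x u. 0 \<le> l (x, u)" "\<And>x. U x \<noteq> {}" "\<And>x. 0 \<le> V0 \<gamma> x" "0 \<le> \<gamma>"
    and bound: "\<And>u. u \<in> U x \<Longrightarrow> b \<le> l (x, u)"
  shows "b \<le> V_iter f U l V0 \<gamma> (Suc j) x"
  unfolding V_iter.simps
proof (rule cINF_greatest)
  show "U x \<noteq> {}" by (fact assms(2))
next
  fix u assume "u \<in> U x"
  moreover have "0 \<le> \<gamma> * V_iter f U l V0 \<gamma> j (f (x, u))"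
    using assms(1-4) by (intro mult_nonneg_nonneg V_iter_nonneg)
  ultimately show "b \<le> l (x, u) + \<gamma> * V_iter f U l V0 \<gamma> j (f (x, u))"
    using bound by fastforce
qed

lemma contraction_rate_eq:
  fixes a_lo a_up \<gamma>s t :: real
  assumes "0 < a_up" "0 < \<gamma>s"
  shows "1 - 1 / \<gamma>s * (a_lo - a_up + \<gamma>s * a_up - t) * inverse a_up
       = (1 - (a_lo - t) / a_up) / \<gamma>s"
  using assms by (simp add: field_simps)

text \<open>A decrease by a multiple of \<open>s\<close> turns into a contraction, since \<open>s\<close> dominates
  \<open>v / a_up\<close>; replacing \<open>\<gamma>\<close> by its lower bound \<open>\<gamma>s\<close> is sound because \<open>w \<ge> 0\<close>.\<close>

lemma contraction_of_decrease:
  fixes v w s d a_up \<gamma> \<gamma>s :: real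
  assumes "0 < a_up" "0 < \<gamma>s" "\<gamma>s \<le> \<gamma>" "0 \<le> w" "0 \<le> d"
    and upper: "v \<le> a_up * s" and decrease: "\<gamma> * w \<le> v - d * s"
  shows "w \<le> (1 - d / a_up) / \<gamma>s * v"
proof -
  have "v / a_up \<le> s"
    using upper \<open>0 < a_up\<close> by (simp add: field_simps)
  then have "d * (v / a_up) \<le> d * s"
    using \<open>0 \<le> d\<close> by (rule mult_left_mono)
  moreover have "\<gamma>s * w \<le> \<gamma> * w"
    using \<open>\<gamma>s \<le> \<gamma>\<close> \<open>0 \<le> w\<close> by (rule mult_right_mono)
  ultimately have "\<gamma>s * w \<le> (1 - d / a_up) * v"
    using decrease by (simp add: algebra_simps)
  then show ?thesis
    using \<open>0 < \<gamma>s\<close> by (simp add: field_simps)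
qed

text \<open>The values of a solution outside its time domain are arbitrary, so the induction relies on
  the domain being an initial segment of the naturals.\<close>

lemma is_solution_geometric_decay:
  fixes V :: "'x \<Rightarrow> real"
  assumes sol: "is_solution F X x D phi" and "k \<in> D" and "0 \<le> r"
    and step: "\<And>z z'. z' \<in> F z \<Longrightarrow> V z' \<le> r * V z"
  shows "V (phi k) \<le> r ^ k * V x"
  using \<open>k \<in> D\<close>
proof (induction k)
  case 0
  then show ?case using sol by (simp add: is_solution_def)
next
  case (Suc k)
  have "k \<in> D"
    using sol Suc.prems by (auto simp: is_solution_def)
  have "V (phi (Suc k)) \<le> r * V (phi k)"
    using sol Suc.prems by (intro step) (simp add: is_solution_def)
  also have "\<dots> \<le> r * (r ^ k * V x)"
    using Suc.IH[OF \<open>k \<in> D\<close>] \<open>0 \<le> r\<close> by (rule mult_left_mono)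
  finally show ?case by (simp add: mult.assoc)
qed

theorem corollary2:
  fixes f :: "(real ^ 'nx) \<times> (real ^ 'nu) \<Rightarrow> real ^ 'nx"
    and U :: "real ^ 'nx \<Rightarrow> (real ^ 'nu) set"
    and l :: "(real ^ 'nx) \<times> (real ^ 'nu) \<Rightarrow> real"
    and V0 :: "real \<Rightarrow> real ^ 'nx \<Rightarrow> real"
    and \<sigma> :: "real ^ 'nx \<Rightarrow> real"
    and \<Theta> :: "(real ^ 'nt) set"
    and c_stop :: "real ^ 'nx \<Rightarrow> real ^ 'nt \<Rightarrow> real \<Rightarrow> nat \<Rightarrow> real"
    and X :: "(real ^ 'nx) set"
    and \<alpha>_lo \<alpha>_up :: "real \<Rightarrow> real"
    and a_lo a_up \<gamma>_star a \<theta>_bar lam :: real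
  assumes l_nonneg: "\<forall>x u. 0 \<le> l (x, u)"
    and V0_nonneg: "\<forall>\<gamma>\<in>{0<..1}. \<forall>x. 0 \<le> V0 \<gamma> x"
    and \<sigma>_cont: "continuous_on UNIV \<sigma>"
    and \<sigma>_range: "range \<sigma> = {0..}"
    and c_stop_nonneg: "\<forall>x. \<forall>\<theta>\<in>\<Theta>. \<forall>\<gamma>\<in>{0<..1}. \<forall>i. 0 \<le> c_stop x \<theta> \<gamma> i"
    and f_cont: "continuous_on UNIV f"
    and U_closed: "\<forall>x. U x \<noteq> {} \<and> closed (U x)"
    and l_lsc: "lower_semicontinuous l"
    and l_coercive: "\<exists>\<alpha>_l. class_K_inf \<alpha>_l \<and> (\<forall>x u. \<alpha>_l (norm u) \<le> l (x, u))"
    and V0_lsc: "\<forall>\<gamma>\<in>{0<..1}. lower_semicontinuous (V0 \<gamma>)"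
    and \<alpha>_lo: "class_K_inf \<alpha>_lo"
    and l_lower: "\<forall>x. \<forall>u\<in>U x. \<alpha>_lo (\<sigma> x) \<le> l (x, u)"
    and \<alpha>_up: "class_K_inf \<alpha>_up"
    and V_iter_upper: "\<forall>i. \<forall>\<gamma>\<in>{0<..1}. \<forall>x. V_iter f U l V0 \<gamma> i x \<le> \<alpha>_up (\<sigma> x)"
    and V_star_upper: "\<forall>\<gamma>\<in>{0<..1}. \<forall>x. V_star f U l \<gamma> x \<le> ennreal (\<alpha>_up (\<sigma> x))"
    and a_pos: "0 < a_up" "0 < a_lo"
    and \<alpha>_up_linear: "\<forall>s\<ge>0. \<alpha>_up s \<le> a_up * s"
    and \<alpha>_lo_linear: "\<forall>s\<ge>0. a_lo * s \<le> \<alpha>_lo s"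
    and c_stop_le: "\<forall>x. \<forall>\<theta>\<in>\<Theta>. \<forall>\<gamma>\<in>{0<..1}. \<forall>i. c_stop x \<theta> \<gamma> i \<le> norm \<theta> * \<sigma> x"
    and \<gamma>_star: "\<gamma>_star \<in> {1 - a_lo / a_up <.. 1}"
    and a_eq: "a = a_lo - a_up + \<gamma>_star * a_up"
    and \<theta>_bar: "\<theta>_bar \<in> {0<..<a}"
    and lam_eq: "lam = 1 - 1 / \<gamma>_star * (a - \<theta>_bar) * inverse a_up"
  shows "lam \<in> {0<..<1} \<and>
    (\<forall>\<theta>\<in>\<Theta>. norm \<theta> \<le> \<theta>_bar \<longrightarrow>
      (\<forall>i\<ge>2. \<forall>\<gamma>\<in>{\<gamma>_star..1}. \<forall>x\<in>X. \<forall>D phi.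
        is_solution (\<lambda>z. (\<lambda>u. f (z, u)) ` H_hat f U l V0 c_stop \<theta> \<gamma> i z) X x D phi \<longrightarrow>
        (\<forall>k\<in>D. \<sigma> (phi k) \<le> a_up / a_lo * lam ^ k * \<sigma> x)))"
proof -
  have U_ne: "U x \<noteq> {}" for x
    using U_closed by blast
  have \<sigma>_nonneg: "0 \<le> \<sigma> x" for x
    using \<sigma>_range by (metis atLeast_iff rangeI)
  have l_linear: "a_lo * \<sigma> x \<le> l (x, u)" if "u \<in> U x" for x u
    using \<alpha>_lo_linear l_lower \<sigma>_nonneg[of x] that order_trans by blast
  have V_nonneg: "0 \<le> V_iter f U l V0 \<gamma> j x" if "\<gamma> \<in> {0<..1}" for \<gamma> j x
    using that l_nonneg U_ne V0_nonneg by (intro V_iter_nonneg) auto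
  have V_lower: "a_lo * \<sigma> x \<le> V_iter f U l V0 \<gamma> (Suc j) x" if "\<gamma> \<in> {0<..1}" for \<gamma> j x
    using that l_nonneg U_ne V0_nonneg l_linear by (intro V_iter_Suc_lower_bound) auto
  have V_upper: "V_iter f U l V0 \<gamma> j x \<le> a_up * \<sigma> x" if "\<gamma> \<in> {0<..1}" for \<gamma> j x
    using that V_iter_upper \<alpha>_up_linear \<sigma>_nonneg[of x] order_trans by blast

  have "a_lo \<le> a_up"
  proof -
    have "1 \<in> range \<sigma>"
      using \<sigma>_range by simp
    then obtain x1 where "\<sigma> x1 = 1"
      by force
    with V_lower[of 1 x1 0] V_upper[of 1 "Suc 0" x1] show ?thesis
      by (simp del: V_iter.simps)
  qed
  then have "0 \<le> 1 - a_lo / a_up"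
    using a_pos by simp
  then have \<gamma>_star_pos: "0 < \<gamma>_star" and \<gamma>_star_le: "\<gamma>_star \<le> 1"
    using \<gamma>_star by auto
  have "\<gamma>_star * a_up \<le> a_up"
    using \<gamma>_star_le a_pos by simp
  then have \<theta>_bar_less: "\<theta>_bar < a_lo"
    using \<theta>_bar a_eq by simp
  have lam_alt: "lam = (1 - (a_lo - \<theta>_bar) / a_up) / \<gamma>_star"
    using contraction_rate_eq[OF a_pos(1) \<gamma>_star_pos] by (simp add: lam_eq a_eq)
  have "0 < lam"
    using \<open>a_lo \<le> a_up\<close> \<theta>_bar a_pos \<gamma>_star_pos by (simp add: lam_alt)
  moreover have "lam < 1"
    using \<theta>_bar a_pos \<gamma>_star_pos by (simp add: lam_eq)

  moreover have "\<sigma> (phi k) \<le> a_up / a_lo * lam ^ k * \<sigma> x"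
    if \<theta>: "\<theta> \<in> \<Theta>" "norm \<theta> \<le> \<theta>_bar" and i: "2 \<le> i" and \<gamma>: "\<gamma> \<in> {\<gamma>_star..1}"
      and sol: "is_solution (\<lambda>z. (\<lambda>u. f (z, u)) ` H_hat f U l V0 c_stop \<theta> \<gamma> i z) X x D phi"
      and k: "k \<in> D"
    for \<theta> i \<gamma> x D phi k
  proof -
    define V where "V = V_iter f U l V0 \<gamma> (i - 1)"
    have \<gamma>': "\<gamma> \<in> {0<..1}"
      using \<gamma> \<gamma>_star_pos by auto
    have "i - 1 = Suc (i - 2)"
      using i by simp
    then have lower: "a_lo * \<sigma> z \<le> V z" for z
      unfolding V_def using V_lower[OF \<gamma>'] by metis
    have upper: "V z \<le> a_up * \<sigma> z" and nonneg: "0 \<le> V z" for z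
      unfolding V_def using V_upper[OF \<gamma>'] V_nonneg[OF \<gamma>'] by blast+
    have step: "V z' \<le> lam * V z"
      if "z' \<in> (\<lambda>u. f (z, u)) ` H_hat f U l V0 c_stop \<theta> \<gamma> i z" for z z'
    proof -
      from that obtain u where u: "u \<in> U z" and z': "z' = f (z, u)"
        and H: "l (z, u) + \<gamma> * V (f (z, u)) \<le> V z + c_stop z \<theta> \<gamma> i"
        by (auto simp: H_hat_def V_def)
      have "c_stop z \<theta> \<gamma> i \<le> norm \<theta> * \<sigma> z"
        using c_stop_le \<theta> \<gamma>' by blast
      also have "\<dots> \<le> \<theta>_bar * \<sigma> z"
        using \<theta>(2) \<sigma>_nonneg by (rule mult_right_mono)
      finally have "\<gamma> * V z' \<le> V z - (a_lo - \<theta>_bar) * \<sigma> z"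
        using H l_linear[OF u] by (simp add: z' algebra_simps)
      then show ?thesis
        unfolding lam_alt using a_pos \<gamma>_star_pos \<gamma> nonneg \<theta>_bar_less upper
        by (intro contraction_of_decrease[where s = "\<sigma> z" and \<gamma> = \<gamma>]) auto
    qed
    have "a_lo * \<sigma> (phi k) \<le> V (phi k)"
      by (rule lower)
    also have "\<dots> \<le> lam ^ k * V x"
      using sol k less_imp_le[OF \<open>0 < lam\<close>] step by (rule is_solution_geometric_decay)
    also have "\<dots> \<le> lam ^ k * (a_up * \<sigma> x)"
      using upper \<open>0 < lam\<close> by (simp add: mult_left_mono)
    finally show ?thesis
      using a_pos by (simp add: field_simps)
  qed
  ultimately show ?thesis
    by auto
qed

end
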